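(* Let $m$ be a positive integer. Let $r_1,\dots,r_m$ be the $m$ roots of $\widetilde P_m$ and let $\omega_1,\dots,\omega_m$ be the $m$ weights of the Gaussian quadrature (with nodes $r_1,\dots,r_m$ and weight function $w(x)=x$ on $[0,1]$) for the polynomials $\widetilde P_0,\widetilde P_1,\dots,\widetilde P_{2m-2}$. Let $\theta_j = j\frac{2\pi}{2m}$ for $j\in\{1,2,\dots,2m\}$, and let $D\subseteq\mathbb{R}^2$ denote the unit disk. Then for all $\ell\in\{0,1\}$ and all $N,n\in\{0,1,2,\dots\}$ such that $N+2n\le 2m-1$, $$\int_D Z_{N,n}^\ell(x)\,dx=\sum_{i=1}^{m}R_{N,n}(r_i)\,\omega_i\sum_{j=1}^{2m}\frac{2\pi}{2m}S_N^\ell(\theta_j).$$ Furthermore, there are exactly $2m^2+m$ Zernike polynomials $Z_{N,n}^\ell$ of degree at most $2m-1$, that is, with $N+2n\le 2m-1$.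
   Context: For $\ell\in\{0,1\}$ and a nonnegative integer $N$, the function $S_N^\ell:\mathbb{R}\to\mathbb{R}$ is defined by $S_0^\ell(\theta)=(2\pi)^{-1/2}$, and for $N>0$, $S_N^0(\theta)=\sin(N\theta)/\sqrt{\pi}$ and $S_N^1(\theta)=\cos(N\theta)/\sqrt{\pi}$. For nonnegative integers $N,n$ the radial polynomial $R_{N,n}$, of degree $N+2n$, is $$R_{N,n}(x)=x^N\sum_{k=0}^n(-1)^k\binom{n+N}{k}\binom{n}{k}(x^2)^{n-k}(1-x^2)^k,\qquad 0\le x\le 1.$$ The Zernike polynomial $Z_{N,n}^\ell$ on the unit disk is $Z_{N,n}^\ell(x)=R_{N,n}(r)S_N^\ell(\theta)$, where $(r,\theta)$ are the polar coordinates of $x\in\mathbb{R}^2$, $\|x\|\le1$; its degree is $N+2n$. Zernike polynomials are counted as distinct functions (for $N=0$ the two values of $\ell$ give the same function, counted once). For a nonnegative integer $n$, $\widetilde P_n:[0,1]\to\mathbb{R}$ is the shifted Jacobi polynomial $\widetilde P_n(x)=\sqrt{2n+2}\,P_n^{(1,0)}(1-2x)$, where $P_n^{(\alpha,\beta)}$ is the Jacobi polynomial of degree $n$ with standard normalization (orthogonal on $(-1,1)$ with respect to $(1-x)^\alpha(1+x)^\beta$). The $\widetilde P_n$ are orthonormal on $[0,1]$ with respect to the weight $w(x)=x$. That $\omega_1,\dots,\omega_m$ are the weights of the Gaussian quadrature for $\widetilde P_0,\dots,\widetilde P_{2m-2}$ means that $\int_0^1\widetilde P_j(x)\,x\,dx=\sum_{i=1}^m\omega_i\widetilde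 P_j(r_i)$ for $j=0,1,\dots,2m-2$; equivalently, the $\omega_i$ are the unique solution of these equations for $j=0,1,\dots,m-1$. *)

theory Defs
  imports "HOL-Analysis.Analysis"
begin

definition zernike_angular :: "nat \<Rightarrow> nat \<Rightarrow> real \<Rightarrow> real" where
  "zernike_angular l N \<theta> =
     (if N = 0 then 1 / sqrt (2 * pi)
      else if l = 0 then sin (real N * \<theta>) / sqrt pi
      else cos (real N * \<theta>) / sqrt pi)"

definition zernike_radial :: "nat \<Rightarrow> nat \<Rightarrow> real \<Rightarrow> real" where
  "zernike_radial N n x =
     x ^ N * (\<Sum>k=0..n. (-1) ^ k * real ((n + N) choose k) * real (n choose k)
                        * (x\<^sup>2) ^ (n - k) * (1 - x\<^sup>2) ^ k)"

abbreviation unit_disk :: "(real ^ 2) set" where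
  "unit_disk \<equiv> cball 0 1"

definition polar_angle :: "real ^ 2 \<Rightarrow> real" where
  "polar_angle x = Arg (Complex (x $ 1) (x $ 2))"

text \<open>
  Zernike polynomials are functions on the closed unit disk; the value is \<^const>\<open>undefined\<close>
  outside it, so two of them are equal iff they agree on the disk. The choice of the branch of the
  angle, and of its value at the origin, is immaterial: see \<open>zernike_polar\<close> below.
\<close>

definition zernike :: "nat \<Rightarrow> nat \<Rightarrow> nat \<Rightarrow> real ^ 2 \<Rightarrow> real" where
  "zernike l N n =
     (\<lambda>x\<in>unit_disk. zernike_radial N n (norm x) * zernike_angular l N (polar_angle x))"

text \<open>
  The Jacobi polynomial \<open>P\<^sub>n\<close> with parameters \<open>\<alpha>, \<beta>\<close>, by the explicit formula obtained from
  the Rodrigues formula and the Leibniz rule. The value at 1 is \<open>(n + \<alpha>) gchoose n\<close>, the standard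
  normalization.
\<close>

definition jacobi :: "real \<Rightarrow> real \<Rightarrow> nat \<Rightarrow> real \<Rightarrow> real" where
  "jacobi \<alpha> \<beta> n x =
     (\<Sum>s=0..n. ((real n + \<alpha>) gchoose (n - s)) * ((real n + \<beta>) gchoose s)
               * ((x - 1) / 2) ^ s * ((x + 1) / 2) ^ (n - s))"

definition shifted_jacobi :: "nat \<Rightarrow> real \<Rightarrow> real" where
  "shifted_jacobi n x = sqrt (2 * real n + 2) * jacobi 1 0 n (1 - 2 * x)"

definition gaussian_weights :: "nat \<Rightarrow> (nat \<Rightarrow> real) \<Rightarrow> (nat \<Rightarrow> real) \<Rightarrow> bool" where
  "gaussian_weights m r \<omega> \<longleftrightarrow>
     (\<forall>j\<in>{0..2 * m - 2}.
        (LBINT x:{0..1}. shifted_jacobi j x * x) = (\<Sum>i=1..m. \<omega> i * shifted_jacobi j (r i)))"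

lemma zernike_polar:
  assumes "0 \<le> r" "r \<le> 1"
  shows "zernike l N n (vector [r * cos \<theta>, r * sin \<theta>])
           = zernike_radial N n r * zernike_angular l N \<theta>"
proof -
  let ?x = "vector [r * cos \<theta>, r * sin \<theta>] :: real ^ 2"
  let ?z = "Complex (r * cos \<theta>) (r * sin \<theta>)"
  have z: "?z = of_real r * cis \<theta>"
    by (simp add: complex_eq_iff)
  have nz: "cmod ?z = r"
    unfolding z using assms by (simp add: norm_mult)
  have nx: "norm ?x = r"
    using nz by (simp add: norm_vec_def L2_set_def sum_2 complex_norm)
  have ang: "zernike_radial N n r * zernike_angular l N (Arg ?z)
               = zernike_radial N n r * zernike_angular l N \<theta>"
  proof (cases "r = 0 \<or> N = 0")
    case True
    then show ?thesis
      by (auto simp: zernike_radial_def zernike_angular_def)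
  next
    case False
    then have "cis (Arg ?z) = cis \<theta>"
      using assms cis_Arg[of ?z] nz unfolding z
      by (simp add: sgn_mult sgn_of_real sgn_eq norm_mult)
    then have "cis (Arg ?z) ^ N = cis \<theta> ^ N"
      by simp
    then have "cis (real N * Arg ?z) = cis (real N * \<theta>)"
      by (simp only: Complex.DeMoivre)
    then show ?thesis
      by (simp add: zernike_angular_def complex_eq_iff)
  qed
  show ?thesis
    using nx assms ang by (simp add: zernike_def polar_angle_def)
qed

lemma jacobi_at_1: "jacobi \<alpha> \<beta> n 1 = (real n + \<alpha>) gchoose n"
proof -
  have "jacobi \<alpha> \<beta> n 1
      = (\<Sum>s=0..n. if s = 0 then (real n + \<alpha>) gchoose n else 0)"
    unfolding jacobi_def by (intro sum.cong) auto
  then show ?thesis by simp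
qed

end

theory Submission
  imports Defs
begin

text \<open>
In polar coordinates both sides factor into a radial and an angular part. When \<open>N > 0\<close>, the angular
part is zero on both sides: the integral because rotating the disk by \<open>pi / N\<close> changes the sign of
the Zernike polynomial (\<open>integral_zernike_nonradial\<close>), the sum because \<open>0 < N < 2 * m\<close> makes it,
up to a factor, the real or imaginary part of a full geometric sum over powers of a nontrivial root of unity
(\<open>sum_zernike_angular\<close>). When \<open>N = 0\<close>, the angular part is a constant, and the area element
\<open>2 * pi * r dr\<close> of the disk (\<open>distr_norm_disk\<close>) turns the integral into one against the weight
\<open>w(x) = x\<close>. The radial polynomial now has even degree \<open>2 * n \<le> 2 * m - 1\<close>, hence degree at most
\<open>2 * m - 2\<close>. The Gaussian quadrature is exact there: it is exact for one polynomial of each such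
degree, and these span (\<open>gaussian_weights_exact\<close>).

For the count, a Zernike polynomial determines its indices (\<open>zernike_inject\<close>): its values on the
unit circle give the angular function, and what remains is a polynomial whose degree gives \<open>n\<close>. It
then suffices to count the index triples.
\<close>

section \<open>Degrees of the Jacobi and radial polynomials\<close>

text \<open>
Every summand \<open>x ^ k * (x - 1) ^ (n - k)\<close> is monic of degree \<open>n\<close>, so the leading
coefficient of the combination is the sum of the \<open>c k\<close>; positivity prevents cancellation. Both the
Jacobi polynomials and the radial polynomials have this shape, with products of binomial
coefficients for the \<open>c k\<close>.
\<close>

lemma bernstein_form_degree:
  fixes c :: "nat \<Rightarrow> real"
  assumes "\<And>k. k \<le> n \<Longrightarrow> c k > 0"
  obtains p where "degree p = n" "p \<noteq> 0" "\<And>x. poly p x = (\<Sum>k\<le>n. c k * x ^ k * (x - 1) ^ (n - k))"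
proof -
  define t where "t k = [:0, 1::real:] ^ k * [:-1, 1:] ^ (n - k)" for k
  define p where "p = (\<Sum>k\<le>n. smult (c k) (t k))"
  have degree_t: "degree (t k) = n" and lead_t: "coeff (t k) n = 1" if "k \<le> n" for k
  proof -
    show "degree (t k) = n"
      using that by (simp add: t_def degree_mult_eq degree_power_eq)
    then have "coeff (t k) n = lead_coeff (t k)" by simp
    also have "\<dots> = 1"
      unfolding t_def lead_coeff_mult lead_coeff_power by simp
    finally show "coeff (t k) n = 1" .
  qed
  have "coeff p n = (\<Sum>k\<le>n. c k)"
    by (simp add: p_def coeff_sum lead_t)
  also have "\<dots> > 0"
    using assms by (intro sum_pos) auto
  finally have "coeff p n \<noteq> 0" by simp
  then have "n \<le> degree p" "p \<noteq> 0"
    by (auto intro: le_degree)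
  moreover have "degree p \<le> n"
    unfolding p_def by (intro degree_sum_le) (auto simp: degree_t intro: order.trans[OF degree_smult_le])
  ultimately have "degree p = n" by simp
  moreover have "poly p x = (\<Sum>k\<le>n. c k * x ^ k * (x - 1) ^ (n - k))" for x
    by (simp add: p_def t_def poly_sum mult.assoc)
  ultimately show ?thesis using that \<open>p \<noteq> 0\<close> by blast
qed

lemma shifted_jacobi_poly:
  obtains p where "degree p = n" "p \<noteq> 0" "\<And>x. poly p x = shifted_jacobi n x"
proof -
  let ?c = "\<lambda>s. ((real n + 1) gchoose (n - s)) * (real n gchoose s)"
  have pos: "?c s > 0" if "s \<le> n" for s
  proof -
    have "?c s = real ((n + 1) choose (n - s)) * real (n choose s)"
      by (metis binomial_gbinomial of_nat_1 of_nat_add)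
    also have "\<dots> > 0" using that by simp
    finally show ?thesis .
  qed
  obtain p where p: "degree p = n" "p \<noteq> 0"
      "\<And>x. poly p x = (\<Sum>s\<le>n. ?c s * x ^ s * (x - 1) ^ (n - s))"
    using bernstein_form_degree[of n ?c] pos by blast
  let ?a = "sqrt (2 * real n + 2) * (-1) ^ n"
  have "poly (smult ?a p) x = shifted_jacobi n x" for x
  proof -
    have "jacobi 1 0 n (1 - 2 * x) = (\<Sum>s\<le>n. ?c s * (- x) ^ s * (1 - x) ^ (n - s))"
    proof -
      have "(1 - 2 * x - 1) / 2 = - x" "(1 - 2 * x + 1) / 2 = 1 - x"
        by (simp_all add: field_simps)
      then show ?thesis
        by (simp only: jacobi_def atMost_atLeast0 add_0_right)
    qed
    also have "\<dots> = (\<Sum>s\<le>n. (-1) ^ n * (?c s * x ^ s * (x - 1) ^ (n - s)))"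
    proof (intro sum.cong refl)
      fix s assume "s \<in> {..n}"
      then have "(-1::real) ^ n = (-1) ^ s * (-1) ^ (n - s)"
        by (simp flip: power_add)
      moreover have "(- x) ^ s = (-1) ^ s * x ^ s" "(1 - x) ^ (n - s) = (-1) ^ (n - s) * (x - 1) ^ (n - s)"
        by (simp_all flip: power_mult_distrib)
      ultimately show "?c s * (- x) ^ s * (1 - x) ^ (n - s) = (-1) ^ n * (?c s * x ^ s * (x - 1) ^ (n - s))"
        by simp
    qed
    finally have "jacobi 1 0 n (1 - 2 * x) = (-1) ^ n * poly p x"
      by (simp only: p(3) sum_distrib_left)
    then show ?thesis
      by (simp add: shifted_jacobi_def)
  qed
  moreover have "degree (smult ?a p) = n" "smult ?a p \<noteq> 0"
    using p(1,2) by simp_all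
  ultimately show ?thesis using that by blast
qed

lemma zernike_radial_poly:
  obtains q where "degree q = n" "\<And>x. zernike_radial N n x = x ^ N * poly q (x\<^sup>2)"
proof -
  let ?c = "\<lambda>k. real ((n + N) choose (n - k)) * real (n choose (n - k))"
  have "?c k > 0" if "k \<le> n" for k
    by simp
  then obtain q where q: "degree q = n"
      "\<And>x. poly q x = (\<Sum>k\<le>n. ?c k * x ^ k * (x - 1) ^ (n - k))"
    using bernstein_form_degree[of n ?c] by blast
  have "zernike_radial N n x = x ^ N * poly q (x\<^sup>2)" for x
  proof -
    have flip: "(1 - x\<^sup>2) ^ k = (-1) ^ k * (x\<^sup>2 - 1) ^ k" for k
      by (simp flip: power_mult_distrib)
    have "(\<Sum>k=0..n. (-1) ^ k * real ((n + N) choose k) * real (n choose k)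
            * (x\<^sup>2) ^ (n - k) * (1 - x\<^sup>2) ^ k)
        = (\<Sum>k=0..n. real ((n + N) choose k) * real (n choose k) * (x\<^sup>2) ^ (n - k) * (x\<^sup>2 - 1) ^ k)"
      by (intro sum.cong refl, subst flip) (simp flip: power_mult_distrib)
    also have "\<dots> = (\<Sum>k\<le>n. ?c k * (x\<^sup>2) ^ k * (x\<^sup>2 - 1) ^ (n - k))"
      unfolding atMost_atLeast0 by (subst sum.atLeastAtMost_rev) (auto intro!: sum.cong)
    finally show ?thesis
      by (simp add: zernike_radial_def q(2))
  qed
  then show ?thesis using that q(1) by blast
qed

lemma zernike_radial_1: "zernike_radial N n 1 = 1"
proof -
  have "(\<Sum>k=0..n. (-1) ^ k * real ((n + N) choose k) * real (n choose k) * (0::real) ^ k)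
      = (\<Sum>k=0..n. if k = 0 then 1 else 0)"
    by (intro sum.cong) auto
  then show ?thesis
    by (simp add: zernike_radial_def)
qed

section \<open>Exactness of the Gaussian quadrature\<close>

text \<open>
Triangular elimination: one nonzero member of each degree up to \<open>d\<close> suffices to cancel leading
terms one after the other. The zero polynomial has to be excluded because its
degree counts as \<open>0\<close>.
\<close>

lemma poly_mem_subspace_of_all_degrees:
  fixes V :: "'a::field poly set"
  assumes basis: "\<And>j. j \<le> d \<Longrightarrow> \<exists>p\<in>V. degree p = j \<and> p \<noteq> 0"
    and zero: "0 \<in> V"
    and add: "\<And>p q. p \<in> V \<Longrightarrow> q \<in> V \<Longrightarrow> p + q \<in> V"
    and smult: "\<And>a p. p \<in> V \<Longrightarrow> smult a p \<in> V"
    and "degree p \<le> d"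
  shows "p \<in> V"
  using \<open>degree p \<le> d\<close>
proof (induction "degree p" arbitrary: p rule: less_induct)
  case less
  obtain b where b: "b \<in> V" "degree b = degree p" "b \<noteq> 0"
    using basis[OF less.prems] by blast
  define a where "a = lead_coeff p / lead_coeff b"
  define q where "q = p - smult a b"
  have "lead_coeff b \<noteq> 0"
    using b(3) by simp
  then have "coeff q (degree p) = 0"
    using b(2) by (simp add: q_def a_def)
  moreover have "degree q \<le> degree p"
    unfolding q_def using b(2) by (intro degree_diff_le) (auto intro: order.trans[OF degree_smult_le])
  ultimately have "q = 0 \<or> degree q < degree p"
    by (metis leading_coeff_0_iff order_le_less)
  then have "q \<in> V"
    using less zero by (metis less_le_trans less_imp_le)
  then have "smult a b + q \<in> V"
    using add smult b(1) by blast
  then show ?case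
    by (simp add: q_def)
qed

text \<open>
The quadrature error is linear in \<open>p\<close>, so exactness passes from the polynomials
\<open>shifted_jacobi j\<close>, one for each degree up to \<open>2 * m - 2\<close>, to everything they span.
\<close>

lemma gaussian_weights_exact:
  assumes "gaussian_weights m r \<omega>" "degree p \<le> 2 * m - 2"
  shows "(LBINT x:{0..1}. poly p x * x) = (\<Sum>i=1..m. \<omega> i * poly p (r i))"
proof -
  let ?I = "\<lambda>p. (LBINT x:{0..1}. poly p x * x)"
  let ?V = "{p. ?I p = (\<Sum>i=1..m. \<omega> i * poly p (r i))}"
  have int: "set_integrable lborel {0..1} (\<lambda>x::real. poly p x * x)" for p
    by (intro borel_integrable_atLeastAtMost' continuous_intros)
  have "p \<in> ?V"
  proof (rule poly_mem_subspace_of_all_degrees[where d = "2 * m - 2"])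
    fix j assume "j \<le> 2 * m - 2"
    obtain q where q: "degree q = j" "q \<noteq> 0" "\<And>x. poly q x = shifted_jacobi j x"
      using shifted_jacobi_poly by blast
    have "q \<in> ?V"
      using assms(1) \<open>j \<le> 2 * m - 2\<close> by (simp add: gaussian_weights_def q(3))
    then show "\<exists>p\<in>?V. degree p = j \<and> p \<noteq> 0"
      using q(1,2) by blast
  next
    fix p q assume "p \<in> ?V" "q \<in> ?V"
    moreover have "?I (p + q) = ?I p + ?I q"
      using set_integral_add(2)[OF int int] by (simp add: ring_distribs)
    ultimately show "p + q \<in> ?V"
      by (simp add: ring_distribs sum.distrib)
  next
    fix a p assume "p \<in> ?V"
    moreover have "?I (smult a p) = a * ?I p"
      by (simp add: mult.assoc)
    ultimately show "smult a p \<in> ?V"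
      by (simp add: sum_distrib_left mult.left_commute)
  qed (use assms(2) in \<open>simp_all add: set_lebesgue_integral_def\<close>)
  then show ?thesis by simp
qed

section \<open>Equispaced sums of the angular functions\<close>

text \<open>
For \<open>0 < N < k\<close> the sample values are the imaginary or real parts of the powers of a \<open>k\<close>-th
root of unity different from \<open>1\<close>, and these powers sum to zero.
\<close>

lemma sum_zernike_angular:
  assumes "N < k" "k > 0"
  shows "(\<Sum>j=1..k. zernike_angular l N (real j * (2 * pi / real k)))
       = (if N = 0 then real k / sqrt (2 * pi) else 0)"
proof (cases "N = 0")
  case False
  let ?u = "cis (real N * (2 * pi / real k))"
  have "?u \<noteq> 1"
  proof
    assume "?u = 1"
    then have "cos (real N * (2 * pi / real k)) = 1"
      by (simp add: complex_eq_iff)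
    then obtain i :: int where "real N * (2 * pi / real k) = of_int i * 2 * pi"
      using cos_one_2pi_int by blast
    then have "real N = of_int i * real k"
      using assms by (simp add: field_simps)
    then have "int N = i * int k"
      by (metis of_int_eq_iff of_int_mult of_int_of_nat_eq)
    then have "k dvd N"
      by (metis dvd_triv_right int_dvd_int_iff)
    then show False
      using assms False by (meson dvd_imp_le not_le neq0_conv)
  qed
  moreover have "?u ^ k = 1"
    using assms cis_multiple_2pi[of "real N"] by (simp add: Complex.DeMoivre mult_ac)
  ultimately have "(\<Sum>j=1..k. ?u ^ j) = 0"
    using sum_gp_multiplied[of 1 k ?u] assms by (simp add: sum_gp)
  then have cis0: "(\<Sum>j=1..k. cis (real N * (real j * (2 * pi / real k)))) = 0"
    by (simp add: Complex.DeMoivre mult_ac)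
  have sums: "(\<Sum>j=1..k. sin (real N * (real j * (2 * pi / real k)))) = 0"
       "(\<Sum>j=1..k. cos (real N * (real j * (2 * pi / real k)))) = 0"
    using arg_cong[OF cis0, of Im] arg_cong[OF cis0, of Re] by (simp_all add: Im_sum Re_sum)
  have "(\<Sum>j=1..k. zernike_angular l N (real j * (2 * pi / real k)))
      = (if l = 0 then \<Sum>j=1..k. sin (real N * (real j * (2 * pi / real k)))
         else \<Sum>j=1..k. cos (real N * (real j * (2 * pi / real k)))) / sqrt pi"
    using False by (simp add: zernike_angular_def sum_divide_distrib)
  then show ?thesis
    by (simp only: sums if_cancel div_0 False if_False)
qed (simp add: zernike_angular_def)

section \<open>Integration over the disk: radial and rotation-odd functions\<close>

lemma unit_disk_borel [measurable]: "unit_disk \<in> sets borel"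
  by (intro borel_closed closed_cball)

lemma borel_measurable_orthogonal_transformation:
  fixes f :: "'a::euclidean_space \<Rightarrow> 'a"
  assumes "orthogonal_transformation f"
  shows "f \<in> borel_measurable borel"
proof -
  have "bounded_linear f"
    using assms orthogonal_transformation_linear linear_conv_bounded_linear by blast
  then show ?thesis
    by (intro borel_measurable_continuous_onI linear_continuous_on)
qed

text \<open>
An orthogonal map preserves the volume of every box, and boxes determine Lebesgue measure.
\<close>

lemma lborel_distr_orthogonal_transformation:
  fixes f :: "real ^ 'n::{finite,wellorder} \<Rightarrow> real ^ 'n::_"
  assumes f: "orthogonal_transformation f"
  shows "distr lborel borel f = lborel"
proof (rule lborel_eqI[symmetric])
  have bij: "bij f" and inv: "orthogonal_transformation (inv f)"
    using f orthogonal_transformation_bij orthogonal_transformation_inv by auto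
  have meas: "f \<in> borel_measurable lborel"
    using borel_measurable_orthogonal_transformation[OF f] by simp
  fix l u :: "real ^ 'n::_"
  assume lu: "\<And>b. b \<in> Basis \<Longrightarrow> l \<bullet> b \<le> u \<bullet> b"
  have pre: "f -` box l u = inv f ` box l u"
    using bij by (simp add: bij_vimage_eq_inv_image)
  have "emeasure (distr lborel borel f) (box l u) = emeasure lborel (f -` box l u)"
    using meas by (simp add: emeasure_distr)
  also have "\<dots> = emeasure lebesgue (inv f ` box l u)"
    unfolding pre[symmetric] using measurable_sets[OF meas, of "box l u"] by simp
  also have "\<dots> = measure lebesgue (inv f ` box l u)"
    using measurable_orthogonal_image[OF inv, of "box l u"] by (intro emeasure_eq_measure2) auto
  also have "\<dots> = measure lebesgue (box l u)"
    using measure_orthogonal_image[OF inv, of "box l u"] by simp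
  also have "\<dots> = (\<Prod>b\<in>Basis. (u - l) \<bullet> b)"
    using lu by (simp add: measure_lborel_box)
  finally show "emeasure (distr lborel borel f) (box l u) = (\<Prod>b\<in>Basis. (u - l) \<bullet> b)" .
qed simp

text \<open>
Polar coordinates for radial functions, with no change of variables: the disk of radius \<open>t\<close> has
area \<open>pi * t\<^sup>2\<close>, and differentiating this gives the density \<open>2 * pi * t\<close> of the norm of a point
of the unit disk. The two measures are compared on the half-lines \<open>{t<..}\<close>.
\<close>

lemma distr_norm_disk:
  "distr (density lborel (indicator unit_disk)) borel norm
     = density lborel (\<lambda>r. ennreal (2 * pi * r) * indicator {0..1} r)" (is "?M = ?N")
proof (rule measure_eqI_lessThan)
  have tail_M: "emeasure ?M {t<..} = (if t < 1 then ennreal (pi - pi * (max t 0)\<^sup>2) else 0)" for t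
  proof -
    have "emeasure ?M {t<..} = emeasure (density lborel (indicator unit_disk)) (norm -` {t<..})"
      by (simp add: emeasure_distr)
    also have "\<dots> = emeasure lborel (unit_disk \<inter> norm -` {t<..})"
      using measurable_sets[of norm borel borel "{t<..}"]
      by (subst emeasure_density) (auto simp flip: indicator_inter_arith)
    also have "\<dots> = (if t < 1 then ennreal (pi - pi * (max t 0)\<^sup>2) else 0)"
    proof (cases "t < 1")
      case True
      consider "t < 0" | "t \<ge> 0" by linarith
      then show ?thesis
      proof cases
        case 1
        then have "unit_disk \<inter> norm -` {t<..} = unit_disk"
          by (auto intro: less_le_trans[OF _ norm_ge_zero])
        then show ?thesis
          using 1 emeasure_cball[of 1 "0 :: real ^ 2"] by (simp add: unit_ball_vol_2)
      next
        case 2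
        have "unit_disk \<inter> norm -` {t<..} = unit_disk - cball 0 t"
          by auto
        moreover have "emeasure lborel (unit_disk - cball 0 t) = ennreal pi - ennreal (pi * t\<^sup>2)"
          using 2 True emeasure_cball[of 1 "0 :: real ^ 2"] emeasure_cball[of t "0 :: real ^ 2"]
          by (subst emeasure_Diff) (auto simp: unit_ball_vol_2)
        ultimately show ?thesis
          using 2 True by (simp add: ennreal_minus)
      qed
    next
      case False
      then have "unit_disk \<inter> norm -` {t<..} = {}"
        by auto
      then show ?thesis using False by simp
    qed
    finally show ?thesis .
  qed
  have tail_N: "emeasure ?N {t<..} = (if t < 1 then ennreal (pi - pi * (max t 0)\<^sup>2) else 0)" for t
  proof -
    have "emeasure ?N {t<..} = (\<integral>\<^sup>+r. ennreal (2 * pi * r) * indicator {max t 0..1} r \<partial>lborel)"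
    proof (subst emeasure_density)
      show "(\<integral>\<^sup>+r. ennreal (2 * pi * r) * indicator {0..1} r * indicator {t<..} r \<partial>lborel)
          = (\<integral>\<^sup>+r. ennreal (2 * pi * r) * indicator {max t 0..1} r \<partial>lborel)"
        by (rule nn_integral_cong_AE, use AE_lborel_singleton[of t] in eventually_elim)
          (auto split: split_indicator)
    qed auto
    also have "\<dots> = (if t < 1 then ennreal (pi - pi * (max t 0)\<^sup>2) else 0)"
    proof (cases "t < 1")
      case True
      have "(\<integral>\<^sup>+r. ennreal (2 * pi * r) * indicator {max t 0..1} r \<partial>lborel)
          = ennreal (pi * 1\<^sup>2 - pi * (max t 0)\<^sup>2)"
        using True by (intro nn_integral_FTC_Icc) (auto intro!: derivative_eq_intros)
      then show ?thesis using True by simp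
    next
      case False
      have "AE r in lborel. ennreal (2 * pi * r) * indicator {max t 0..1} r = 0"
        using AE_lborel_singleton[of 1] by eventually_elim (use False in \<open>auto split: split_indicator\<close>)
      then show ?thesis using False by (simp add: nn_integral_0_iff_AE)
    qed
    finally show ?thesis .
  qed
  fix t :: real
  show "emeasure ?M {t<..} < \<infinity>"
    by (simp add: tail_M)
  show "emeasure ?M {t<..} = emeasure ?N {t<..}"
    by (simp add: tail_M tail_N)
qed simp_all

lemma integral_disk_radial:
  fixes f :: "real \<Rightarrow> real"
  assumes [measurable]: "f \<in> borel_measurable borel"
  shows "(LBINT x:unit_disk. f (norm x)) = 2 * pi * (LBINT r:{0..1}. f r * r)"
proof -
  have "(LBINT x:unit_disk. f (norm x)) = (\<integral>x. f (norm x) \<partial>density lborel (indicator unit_disk :: real ^ 2 \<Rightarrow> real))"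
    unfolding set_lebesgue_integral_def by (subst integral_density) auto
  also have "\<dots> = (\<integral>r. f r \<partial>distr (density lborel (indicator unit_disk)) borel (norm :: real ^ 2 \<Rightarrow> real))"
    by (subst integral_distr) (auto simp: ennreal_indicator)
  also have "\<dots> = (\<integral>r. f r \<partial>density lborel (\<lambda>r. ennreal (2 * pi * r * indicator {0..1} r)))"
    unfolding distr_norm_disk by (simp add: ennreal_mult'' ennreal_indicator)
  also have "\<dots> = (\<integral>r. 2 * pi * (indicator {0..1} r * (f r * r)) \<partial>lborel)"
    by (subst integral_density) (auto simp: mult_ac split: split_indicator)
  finally show ?thesis
    by (simp add: set_lebesgue_integral_def)
qed

text \<open>
Replaces Fubini in the angle: the disk is invariant under \<open>T\<close>, so a function that changes sign
under \<open>T\<close> has an integral equal to its own negative.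
\<close>

lemma integral_disk_odd_rotation:
  fixes f :: "real ^ 2 \<Rightarrow> real" and T :: "real ^ 2 \<Rightarrow> real ^ 2"
  assumes T: "orthogonal_transformation T"
    and odd: "\<And>x. x \<in> unit_disk \<Longrightarrow> f (T x) = - f x"
    and int: "set_integrable lborel unit_disk f"
  shows "(LBINT x:unit_disk. f x) = 0"
proof -
  let ?g = "\<lambda>x. indicator unit_disk x *\<^sub>R f x"
  have T_meas: "T \<in> borel_measurable lborel"
    using borel_measurable_orthogonal_transformation[OF T] by simp
  have "?g \<in> borel_measurable borel"
    using int by (auto simp: set_integrable_def)
  then have "(\<integral>x. ?g x \<partial>distr lborel borel T) = (\<integral>x. ?g (T x) \<partial>lborel)"
    using T_meas by (intro integral_distr) auto
  also have "\<dots> = (\<integral>x. - ?g x \<partial>lborel)"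
    using odd T by (intro Bochner_Integration.integral_cong)
      (auto simp: orthogonal_transformation_norm split: split_indicator)
  finally show ?thesis
    by (simp add: lborel_distr_orthogonal_transformation[OF T] set_lebesgue_integral_def)
qed

text \<open>
Viewing the plane as \<open>\<complex>\<close> turns rotations into multiplications and Zernike polynomials into
polynomial expressions in \<open>z\<close> and \<open>norm z\<close>.
\<close>

abbreviation plane_complex :: "real ^ 2 \<Rightarrow> complex" where
  "plane_complex x \<equiv> Complex (x $ 1) (x $ 2)"

lemma norm_plane_complex: "cmod (plane_complex x) = norm x"
  by (simp add: norm_vec_def L2_set_def sum_2 complex_norm)

lemma orthogonal_plane_rotation:
  obtains T where "orthogonal_transformation T"
    "\<And>x. plane_complex (T x) = cis \<phi> * plane_complex x"
proof
  let ?T = "\<lambda>x :: real ^ 2. vector [cos \<phi> * x $ 1 - sin \<phi> * x $ 2, sin \<phi> * x $ 1 + cos \<phi> * x $ 2] :: real ^ 2"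
  show T: "plane_complex (?T x) = cis \<phi> * plane_complex x" for x
    by (simp add: complex_eq_iff)
  have "norm (?T x) = norm x" for x
  proof -
    have "norm (?T x) = cmod (plane_complex (?T x))"
      by (simp only: norm_plane_complex)
    also have "\<dots> = norm x"
      by (simp only: T norm_mult norm_cis norm_plane_complex mult_1)
    finally show ?thesis .
  qed
  moreover have "linear ?T"
    by (intro linearI) (auto simp: vec_eq_iff forall_2 algebra_simps)
  ultimately show "orthogonal_transformation ?T"
    by (simp add: orthogonal_transformation)
qed

section \<open>Integrals of Zernike polynomials\<close>

text \<open>
De Moivre's formula absorbs the factor \<open>norm x ^ N\<close> of the radial polynomial into a power of the
point. In this form there is no choice of angle left, so continuity and the behaviour under
rotations are visible.
\<close>

lemma zernike_power:
  assumes "\<And>x. zernike_radial N n x = x ^ N * poly q (x\<^sup>2)" "x \<in> unit_disk"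
  shows "zernike l N n x = poly q ((norm x)\<^sup>2) *
    (if N = 0 then 1 / sqrt (2 * pi)
     else (if l = 0 then Im else Re) (plane_complex x ^ N) / sqrt pi)"
proof -
  have "plane_complex x = of_real (norm x) * cis (polar_angle x)"
    using rcis_cmod_Arg[of "plane_complex x"] unfolding polar_angle_def
    by (simp add: rcis_def norm_plane_complex)
  then have "plane_complex x ^ N = of_real (norm x ^ N) * cis (real N * polar_angle x)"
    by (simp add: power_mult_distrib Complex.DeMoivre)
  then show ?thesis
    using assms by (simp add: zernike_def zernike_angular_def)
qed

lemma set_integrable_zernike: "set_integrable lborel unit_disk (zernike l N n)"
proof -
  obtain q where q: "\<And>x. zernike_radial N n x = x ^ N * poly q (x\<^sup>2)"
    using zernike_radial_poly by blast
  have "continuous_on unit_disk (\<lambda>x. poly q ((norm x)\<^sup>2) *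
    (if N = 0 then 1 / sqrt (2 * pi) else (if l = 0 then Im else Re) (plane_complex x ^ N) / sqrt pi))"
    by (cases "N = 0"; cases "l = 0") (auto simp: complex_eq intro!: continuous_intros)
  then have "continuous_on unit_disk (zernike l N n)"
    by (rule continuous_on_eq) (simp add: zernike_power[OF q])
  then show ?thesis
    unfolding set_integrable_def by (intro borel_integrable_compact) auto
qed

text \<open>
Rotation by the angle \<open>pi / N\<close> multiplies \<open>z ^ N\<close> by \<open>cis pi = -1\<close>, hence reverses the sign.
\<close>

lemma integral_zernike_nonradial:
  assumes "N > 0"
  shows "(LBINT x:unit_disk. zernike l N n x) = 0"
proof -
  obtain T where T: "orthogonal_transformation T"
      "\<And>x. plane_complex (T x) = cis (pi / real N) * plane_complex x"
    using orthogonal_plane_rotation by blast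
  obtain q where q: "\<And>x. zernike_radial N n x = x ^ N * poly q (x\<^sup>2)"
    using zernike_radial_poly by blast
  have norm_T: "norm (T x) = norm x" for x
    using T(1) by (simp add: orthogonal_transformation_norm)
  have "zernike l N n (T x) = - zernike l N n x" if "x \<in> unit_disk" for x
  proof -
    have "plane_complex (T x) ^ N = - (plane_complex x ^ N)"
      using assms by (simp add: T(2) power_mult_distrib Complex.DeMoivre)
    then show ?thesis
      using that assms by (simp add: zernike_power[OF q] norm_T)
  qed
  then show ?thesis
    using integral_disk_odd_rotation[OF T(1)] set_integrable_zernike by blast
qed

text \<open>
For \<open>N = 0\<close> the function is a polynomial of degree \<open>2 * n\<close> in the norm, divided by
\<open>sqrt (2 * pi)\<close>. Its integral is a one-dimensional integral with the weight \<open>x\<close> of the Gaussian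
quadrature.
\<close>

lemma integral_zernike_axisymmetric:
  assumes "gaussian_weights m r \<omega>" "2 * n \<le> 2 * m - 2"
  shows "(LBINT x:unit_disk. zernike l 0 n x)
       = (\<Sum>i=1..m. zernike_radial 0 n (r i) * \<omega> i * (2 * pi / sqrt (2 * pi)))"
proof -
  obtain q where q: "degree q = n" "\<And>x. zernike_radial 0 n x = x ^ 0 * poly q (x\<^sup>2)"
    using zernike_radial_poly by blast
  define p where "p = q \<circ>\<^sub>p [:0, 0, 1:]"
  have poly_p: "poly p x = poly q (x\<^sup>2)" for x
    by (simp add: p_def poly_pcompose power2_eq_square)
  have "degree p \<le> 2 * m - 2"
    using assms(2) q(1) by (simp add: p_def degree_pcompose)
  note exact = gaussian_weights_exact[OF assms(1) this]
  have "(LBINT x:unit_disk. zernike l 0 n x) = (LBINT x:unit_disk. poly p (norm x) / sqrt (2 * pi))"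
    by (intro set_lebesgue_integral_cong) (auto simp: zernike_power[OF q(2)] poly_p)
  also have "\<dots> = (LBINT x:unit_disk. poly p (norm x)) / sqrt (2 * pi)"
    by (rule set_integral_divide_zero)
  also have "(LBINT x:unit_disk. poly p (norm x)) = 2 * pi * (LBINT t:{0..1}. poly p t * t)"
    by (intro integral_disk_radial borel_measurable_continuous_onI continuous_intros)
  also have "\<dots> / sqrt (2 * pi) = (\<Sum>i=1..m. zernike_radial 0 n (r i) * \<omega> i * (2 * pi / sqrt (2 * pi)))"
    unfolding exact by (simp add: q(2) poly_p sum_distrib_left sum_divide_distrib mult_ac)
  finally show ?thesis .
qed

section \<open>Distinctness and number of the Zernike polynomials\<close>

text \<open>
The witness is the first positive point \<open>pi / N'\<close> at which the faster cosine reaches \<open>-1\<close> and the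
faster sine returns to \<open>0\<close>; the slower function has not got there yet.
\<close>

lemma zernike_angular_frequency_separated:
  assumes "0 < N" "N < N'"
  shows "\<exists>\<theta>. zernike_angular l N \<theta> \<noteq> zernike_angular l N' \<theta>"
proof (intro exI)
  define a b where "a = real N * (pi / real N')" and "b = real N' * (pi / real N')"
  have "0 < a" "a < pi" "b = pi"
    using assms by (simp_all add: a_def b_def field_simps)
  then have "sin a > sin b" "cos a > cos b"
    by (auto intro: sin_gt_zero cos_monotone_0_pi simp del: cos_pi)
  moreover have
      "zernike_angular l N (pi / real N') = (if l = 0 then sin a else cos a) / sqrt pi"
      "zernike_angular l N' (pi / real N') = (if l = 0 then sin b else cos b) / sqrt pi"
    using assms by (simp_all add: zernike_angular_def a_def b_def)
  ultimately show "zernike_angular l N (pi / real N') \<noteq> zernike_angular l N' (pi / real N')"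
    by auto
qed

text \<open>
The values at \<open>0\<close> are \<open>1 / sqrt (2 * pi)\<close> for the constant, \<open>0\<close> for sines and \<open>1 / sqrt pi\<close> for
cosines, so they separate the three kinds; the frequency is then settled by
\<open>zernike_angular_frequency_separated\<close>.
\<close>

lemma zernike_angular_inject:
  assumes eq: "\<And>\<theta>. zernike_angular l N \<theta> = zernike_angular l' N' \<theta>"
    and l: "l \<in> {0, 1}" "N = 0 \<Longrightarrow> l = 0" and l': "l' \<in> {0, 1}" "N' = 0 \<Longrightarrow> l' = 0"
  shows "N = N' \<and> l = l'"
proof -
  have "sqrt (2 * pi) \<noteq> sqrt pi"
    by simp
  then have same: "N = 0 \<longleftrightarrow> N' = 0" "l = l'"
    using eq[of 0] l l' by (auto simp: zernike_angular_def split: if_splits)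
  moreover have "\<not> N < N'" if "N > 0"
    using zernike_angular_frequency_separated[of N N' l] that eq same by auto
  moreover have "\<not> N' < N" if "N' > 0"
    using zernike_angular_frequency_separated[of N' N l] that eq same by metis
  ultimately show ?thesis
    by (metis neq0_conv linorder_neqE_nat)
qed

lemma zernike_angular_nonzero: "\<exists>\<theta>. zernike_angular l N \<theta> \<noteq> 0"
proof (cases "N = 0 \<or> l \<noteq> 0")
  case True
  then have "zernike_angular l N 0 \<noteq> 0"
    by (auto simp: zernike_angular_def)
  then show ?thesis ..
next
  case False
  then have "zernike_angular l N (pi / 2 / real N) \<noteq> 0"
    by (simp add: zernike_angular_def)
  then show ?thesis ..
qed

text \<open>
After cancelling \<open>x ^ N\<close>, the polynomials in \<open>x\<^sup>2\<close> agree on \<open>{0<..1}\<close>, hence are equal, and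
their degrees are \<open>n\<close> and \<open>n'\<close>.
\<close>

lemma zernike_radial_inject:
  assumes eq: "\<And>x. 0 \<le> x \<Longrightarrow> x \<le> 1 \<Longrightarrow> zernike_radial N n x = zernike_radial N n' x"
  shows "n = n'"
proof -
  obtain q where q: "degree q = n" "\<And>x. zernike_radial N n x = x ^ N * poly q (x\<^sup>2)"
    using zernike_radial_poly by blast
  obtain q' where q': "degree q' = n'" "\<And>x. zernike_radial N n' x = x ^ N * poly q' (x\<^sup>2)"
    using zernike_radial_poly by blast
  have "poly (q - q') t = 0" if "t \<in> {0<..1}" for t
  proof -
    have "zernike_radial N n (sqrt t) = zernike_radial N n' (sqrt t)"
      using that by (intro eq) auto
    then show ?thesis
      using that by (simp add: q(2) q'(2))
  qed
  then have "{0<..1} \<subseteq> {t. poly (q - q') t = 0}"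
    by blast
  moreover have "infinite {0<..1::real}"
    by (simp add: infinite_Ioc)
  ultimately have "q - q' = 0"
    using poly_roots_finite finite_subset by blast
  then show ?thesis
    using q(1) q'(1) by simp
qed

text \<open>
On the boundary circle all radial factors are \<open>1\<close>, so the angular functions must agree; dividing
by a nonzero angular value leaves the radial ones.
\<close>

lemma zernike_inject:
  assumes eq: "zernike l N n = zernike l' N' n'"
    and l: "l \<in> {0, 1}" "N = 0 \<Longrightarrow> l = 0" and l': "l' \<in> {0, 1}" "N' = 0 \<Longrightarrow> l' = 0"
  shows "l = l' \<and> N = N' \<and> n = n'"
proof -
  have polar: "zernike_radial N n x * zernike_angular l N \<theta>
      = zernike_radial N' n' x * zernike_angular l' N' \<theta>" if "0 \<le> x" "x \<le> 1" for x \<theta>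
    using zernike_polar[OF that] eq by metis
  have "zernike_angular l N \<theta> = zernike_angular l' N' \<theta>" for \<theta>
    using polar[of 1 \<theta>] by (simp add: zernike_radial_1)
  then have "N = N' \<and> l = l'"
    by (rule zernike_angular_inject) (use l l' in auto)
  then have same: "N = N'" "l = l'"
    by simp_all
  obtain \<theta> where "zernike_angular l N \<theta> \<noteq> 0"
    using zernike_angular_nonzero by blast
  then have "zernike_radial N n x = zernike_radial N n' x" if "0 \<le> x" "x \<le> 1" for x
    using polar[OF that, of \<theta>] same by simp
  then show ?thesis
    using zernike_radial_inject same by blast
qed

text \<open>
For fixed \<open>n < m\<close> there are one axisymmetric function and two for each of the
\<open>2 * m - 1 - 2 * n\<close> positive frequencies, so the total is the sum of \<open>4 * i + 3\<close> over
\<open>i = m - 1 - n < m\<close>.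
\<close>

lemma card_zernike:
  assumes "m > 0"
  shows "card {zernike l N n | l N n. l \<in> {0, 1} \<and> N + 2 * n \<le> 2 * m - 1} = 2 * m ^ 2 + m"
    (is "card ?Z = _")
proof -
  let ?index = "SIGMA n:{..<m}. insert (0, 0) ({1..2 * m - 1 - 2 * n} \<times> {0, 1::nat})"
  let ?f = "\<lambda>(n, N, l). zernike l N n"
  have "?Z = ?f ` ?index"
  proof (intro equalityI subsetI)
    fix z assume "z \<in> ?Z"
    then obtain l N n where z: "z = zernike l N n" "l \<in> {0, 1}" "N + 2 * n \<le> 2 * m - 1"
      by blast
    \<comment> \<open>for frequency zero both parities give the same function; the index set keeps parity zero\<close>
    have "z = ?f (n, N, if N = 0 then 0 else l)"
      by (simp add: z(1) zernike_def zernike_angular_def)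
    moreover have "(n, N, if N = 0 then 0 else l) \<in> ?index"
      using z(2,3) assms by auto
    ultimately show "z \<in> ?f ` ?index"
      by (rule image_eqI)
  next
    fix z assume "z \<in> ?f ` ?index"
    then obtain n N l where "z = zernike l N n" "l \<in> {0, 1}" "N + 2 * n \<le> 2 * m - 1"
      using assms by fastforce
    then show "z \<in> ?Z" by blast
  qed
  moreover have "inj_on ?f ?index"
  proof (rule inj_onI)
    fix a b
    assume ab: "a \<in> ?index" "b \<in> ?index" "?f a = ?f b"
    obtain n N l n' N' l' where eqs: "a = (n, N, l)" "b = (n', N', l')"
      by (cases a, cases b) auto
    have "l = l' \<and> N = N' \<and> n = n'"
      using ab unfolding eqs by (intro zernike_inject) auto
    then show "a = b"
      by (simp add: eqs)
  qed
  ultimately have "card ?Z = card ?index"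
    by (simp add: card_image)
  also have "\<dots> = (\<Sum>n<m. 1 + 2 * (2 * m - 1 - 2 * n))"
    by (subst card_SigmaI) (auto simp: card_cartesian_product intro!: sum.cong)
  also have "\<dots> = (\<Sum>i<m. 1 + 2 * (2 * m - 1 - 2 * (m - Suc i)))"
    by (rule sum.nat_diff_reindex[symmetric])
  also have "\<dots> = (\<Sum>i<m. 4 * i + 3)"
    by (intro sum.cong) auto
  also have "\<dots> = 2 * m ^ 2 + m"
    by (induction m) (auto simp: power2_eq_square)
  finally show ?thesis .
qed

section \<open>The quadrature formula\<close>

theorem theorem4p2:
  fixes m :: nat and r \<omega> \<theta> :: "nat \<Rightarrow> real"
  assumes "m > 0"
    and "bij_betw r {1..m} {x \<in> {0..1}. shifted_jacobi m x = 0}"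
    and "gaussian_weights m r \<omega>"
    and "\<And>j. j \<in> {1..2 * m} \<Longrightarrow> \<theta> j = real j * (2 * pi / real (2 * m))"
  shows "(\<forall>l \<in> {0, 1}. \<forall>N n. N + 2 * n \<le> 2 * m - 1 \<longrightarrow>
            set_integrable lborel unit_disk (zernike l N n) \<and>
            (LBINT x:unit_disk. zernike l N n x) =
              (\<Sum>i=1..m. zernike_radial N n (r i) * \<omega> i *
                 (\<Sum>j=1..2 * m. 2 * pi / real (2 * m) * zernike_angular l N (\<theta> j))))
       \<and> card {zernike l N n | l N n. l \<in> {0, 1} \<and> N + 2 * n \<le> 2 * m - 1} = 2 * m ^ 2 + m"
proof (intro conjI ballI allI impI)
  fix l N n :: nat
  assume deg: "N + 2 * n \<le> 2 * m - 1"
  show "set_integrable lborel unit_disk (zernike l N n)"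
    by (rule set_integrable_zernike)
  have "(\<Sum>j=1..2 * m. zernike_angular l N (\<theta> j))
      = (\<Sum>j=1..2 * m. zernike_angular l N (real j * (2 * pi / real (2 * m))))"
    using assms(4) by (intro sum.cong) auto
  also have "\<dots> = (if N = 0 then real (2 * m) / sqrt (2 * pi) else 0)"
    using deg assms(1) by (intro sum_zernike_angular) auto
  finally have sum: "(\<Sum>j=1..2 * m. zernike_angular l N (\<theta> j)) = \<dots>" .
  have angular: "(\<Sum>j=1..2 * m. 2 * pi / real (2 * m) * zernike_angular l N (\<theta> j))
      = (if N = 0 then 2 * pi / sqrt (2 * pi) else 0)"
    using assms(1) by (simp only: sum flip: sum_distrib_left) simp
  show "(LBINT x:unit_disk. zernike l N n x) =
      (\<Sum>i=1..m. zernike_radial N n (r i) * \<omega> i *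
         (\<Sum>j=1..2 * m. 2 * pi / real (2 * m) * zernike_angular l N (\<theta> j)))"
  proof (cases "N = 0")
    case True
    \<comment> \<open>an even degree at most \<open>2 * m - 1\<close> is at most \<open>2 * m - 2\<close>, the last exact degree\<close>
    have "2 * n \<le> 2 * m - 2"
      using deg True by presburger
    then show ?thesis
      unfolding angular using True integral_zernike_axisymmetric[OF assms(3)] by simp
  next
    case False
    then show ?thesis
      unfolding angular by (simp add: integral_zernike_nonradial)
  qed
qed (rule card_zernike[OF assms(1)])

end
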